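(* Let $\Omega$ be a domain in $\mathbb{C}^2$. Then $\Omega$ is biholomorphic to $G$ if and only if there exists a differentiable homeomorphism $\Xi=(\xi_1,\xi_2)$ from $\mathbb{D}^2$ onto $\Omega$ satisfying $$\frac{\partial\xi_i}{\partial\bar\beta}=z\,\frac{\partial\xi_i}{\partial\beta},\qquad i=1,2,$$ and $$\frac{\partial\xi_i}{\partial\bar z}=0,\qquad i=1,2,$$ at all points $(\beta,z)\in\mathbb{D}^2$.
   Context: $\mathbb{D}$ is the open unit disc in $\mathbb{C}$ and $G=\{(z+w,zw):z,w\in\mathbb{D}\}\subset\mathbb{C}^2$ is the symmetrized bidisc. A domain is a connected open set. The variables of $\mathbb{D}^2$ are denoted $(\beta,z)$, "differentiable" is in the real sense, and $\partial/\partial\beta,\partial/\partial\bar\beta,\partial/\partial\bar z$ are the Wirtinger derivatives. *)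

theory Defs
  imports "HOL-Analysis.Analysis"
begin

abbreviation unit_disc :: "complex set"
  where "unit_disc \<equiv> ball 0 1"

definition symmetrized_bidisc :: "(complex \<times> complex) set"
  where "symmetrized_bidisc = {(z + w, z * w) | z w. z \<in> unit_disc \<and> w \<in> unit_disc}"

text \<open>
  \<^const>\<open>has_derivative\<close> is the real Frechet derivative; the scalar-valued function \<open>f\<close> is
  complex differentiable at \<open>p\<close> iff this derivative is \<open>\<complex>\<close>-linear, i.e. of the form
  \<open>(h, k) \<mapsto> a h + b k\<close>.  The definition is meant for open \<open>U\<close>.
\<close>
definition holomorphic2_on :: "(complex \<times> complex \<Rightarrow> complex) \<Rightarrow> (complex \<times> complex) set \<Rightarrow> bool"
  where "holomorphic2_on f U \<longleftrightarrow>
    (\<forall>p\<in>U. \<exists>a b. (f has_derivative (\<lambda>(h, k). a * h + b * k)) (at p))"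

definition holomorphic_map_on ::
    "(complex \<times> complex \<Rightarrow> complex \<times> complex) \<Rightarrow> (complex \<times> complex) set \<Rightarrow> bool"
  where "holomorphic_map_on F U \<longleftrightarrow>
    holomorphic2_on (fst \<circ> F) U \<and> holomorphic2_on (snd \<circ> F) U"

definition biholomorphic :: "(complex \<times> complex) set \<Rightarrow> (complex \<times> complex) set \<Rightarrow> bool"
  where "biholomorphic U V \<longleftrightarrow>
    (\<exists>F H. holomorphic_map_on F U \<and> holomorphic_map_on H V \<and> F ` U = V \<and> H ` V = U \<and>
      (\<forall>p\<in>U. H (F p) = p) \<and> (\<forall>q\<in>V. F (H q) = q))"

text \<open>
  Wirtinger derivatives \<open>(\<partial>\<^sub>x - \<i> \<partial>\<^sub>y) / 2\<close> and \<open>(\<partial>\<^sub>x + \<i> \<partial>\<^sub>y) / 2\<close> of a function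
  of one complex variable \<open>x + \<i> y\<close>.  For a function of two complex variables they are applied to
  its slices.  They are meaningful only where the function is real differentiable.
\<close>
definition wirtinger :: "(complex \<Rightarrow> complex) \<Rightarrow> complex \<Rightarrow> complex"
  where "wirtinger f z =
    (frechet_derivative f (at z) 1 - \<i> * frechet_derivative f (at z) \<i>) / 2"

definition wirtinger_bar :: "(complex \<Rightarrow> complex) \<Rightarrow> complex \<Rightarrow> complex"
  where "wirtinger_bar f z =
    (frechet_derivative f (at z) 1 + \<i> * frechet_derivative f (at z) \<i>) / 2"

end

theory Submission
  imports Defs "HOL-Complex_Analysis.Complex_Analysis"
begin

text \<open>
  The map \<open>sym_param (\<beta>, z) = (\<beta> + z cnj \<beta>, z)\<close> is a real analytic diffeomorphism from the bidisc onto
  the symmetrized bidisc.  Its first component, like its second, satisfies the two differential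
  equations, and more is true: a differentiable function on the bidisc satisfies them if and only if
  it is a holomorphic function of \<open>s = \<beta> + z cnj \<beta>\<close> and \<open>p = z\<close> (\<open>wirtinger_slices_sym_param\<close>,
  \<open>holomorphic_in_symmetric_coordinates\<close>).  So a differentiable homeomorphism \<open>\<Xi>\<close> from the bidisc
  onto \<open>\<Omega>\<close> solves the equations if and only if \<open>H = \<Xi> \<circ> sym_coords\<close>, where \<open>sym_coords\<close> is the inverse of
  \<open>sym_param\<close>, is a holomorphic homeomorphism from the symmetrized bidisc onto \<open>\<Omega>\<close>.

  A biholomorphic map is such a homeomorphism.  The converse is the analytic core: the inverse of \<open>H\<close>
  is only known to be continuous, so one needs the theorem of Osgood that an injective holomorphic
  map from an open subset of \<open>\<complex>\<^sup>2\<close> to \<open>\<complex>\<^sup>2\<close> has nonvanishing Jacobian determinant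
  (\<open>jacobian2_nonzero_if_injective\<close>).  Its proof uses, for functions of two variables, that
  partial derivatives of holomorphic functions are holomorphic (by Cauchy's integral formula in one
  variable, \<open>holomorphic2_on_partial_snd\<close>), the implicit function theorem (\<open>implicit_function_snd\<close>),
  and the persistence of zeros under perturbation of a parameter (\<open>zeros_persist\<close>, by Hurwitz's
  theorem).
\<close>

section \<open>Holomorphic functions of two variables\<close>

definition partial_fst :: "(complex \<times> complex \<Rightarrow> complex) \<Rightarrow> complex \<times> complex \<Rightarrow> complex"
  where "partial_fst f p = deriv (\<lambda>x. f (x, snd p)) (fst p)"

definition partial_snd :: "(complex \<times> complex \<Rightarrow> complex) \<Rightarrow> complex \<times> complex \<Rightarrow> complex"
  where "partial_snd f p = deriv (\<lambda>y. f (fst p, y)) (snd p)"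

lemma slices_has_derivative:
  assumes "(f has_derivative L) (at (b, z))"
  shows "((\<lambda>x. f (x, z)) has_derivative (\<lambda>h. L (h, 0))) (at b)"
    and "((\<lambda>y. f (b, y)) has_derivative (\<lambda>k. L (0, k))) (at z)"
proof -
  have "((f \<circ> (\<lambda>x. (x, z))) has_derivative (L \<circ> (\<lambda>h. (h, 0)))) (at b)"
    by (rule diff_chain_at) (use assms in \<open>auto intro!: derivative_eq_intros\<close>)
  then show "((\<lambda>x. f (x, z)) has_derivative (\<lambda>h. L (h, 0))) (at b)" by (simp add: o_def)
  have "((f \<circ> (\<lambda>y. (b, y))) has_derivative (L \<circ> (\<lambda>k. (0, k)))) (at z)"
    by (rule diff_chain_at) (use assms in \<open>auto intro!: derivative_eq_intros\<close>)
  then show "((\<lambda>y. f (b, y)) has_derivative (\<lambda>k. L (0, k))) (at z)" by (simp add: o_def)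
qed

lemma has_complex_derivative_slices:
  assumes "(f has_derivative (\<lambda>(h, k). a * h + b * k)) (at (z, w))"
  shows "((\<lambda>x. f (x, w)) has_field_derivative a) (at z)"
    and "((\<lambda>y. f (z, y)) has_field_derivative b) (at w)"
  using slices_has_derivative[OF assms] by (simp_all add: has_field_derivative_def)

lemma holomorphic2_on_has_derivative:
  assumes "holomorphic2_on f U" and "p \<in> U"
  shows "(f has_derivative (\<lambda>(h, k). partial_fst f p * h + partial_snd f p * k)) (at p)"
proof -
  obtain a b where ab: "(f has_derivative (\<lambda>(h, k). a * h + b * k)) (at (fst p, snd p))"
    using assms by (force simp: holomorphic2_on_def)
  note has_complex_derivative_slices[OF this, THEN DERIV_imp_deriv]
  with ab show ?thesis by (simp add: partial_fst_def partial_snd_def)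
qed

lemma holomorphic2_on_slices:
  assumes "holomorphic2_on f U" and "(z, w) \<in> U"
  shows "((\<lambda>x. f (x, w)) has_field_derivative partial_fst f (z, w)) (at z)"
    and "((\<lambda>y. f (z, y)) has_field_derivative partial_snd f (z, w)) (at w)"
  using has_complex_derivative_slices[OF holomorphic2_on_has_derivative[OF assms]] by auto

lemma holomorphic2_on_imp_continuous_on:
  "holomorphic2_on f U \<Longrightarrow> continuous_on U f"
  by (meson continuous_at_imp_continuous_on has_derivative_continuous
      holomorphic2_on_has_derivative)

lemma bounded_linear_swap: "bounded_linear (prod.swap :: complex \<times> complex \<Rightarrow> complex \<times> complex)"
  unfolding prod.swap_def by (intro bounded_linear_intros)

lemma open_image_swap:
  fixes U :: "(complex \<times> complex) set"
  assumes "open U"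
  shows "open (prod.swap ` U)"
proof -
  have "open (prod.swap -` U)"
    by (rule open_vimage[OF assms linear_continuous_on[OF bounded_linear_swap]])
  moreover have "prod.swap ` U = prod.swap -` U" by force
  ultimately show ?thesis by simp
qed

lemma holomorphic2_on_swap:
  assumes "holomorphic2_on f U"
  shows "holomorphic2_on (f \<circ> prod.swap) (prod.swap ` U)"
  unfolding holomorphic2_on_def
proof
  fix q assume "q \<in> prod.swap ` U"
  then obtain z w where "(z, w) \<in> U" and q: "q = (w, z)" by auto
  have "((f \<circ> prod.swap) has_derivative
      ((\<lambda>(h, k). partial_fst f (z, w) * h + partial_snd f (z, w) * k) \<circ> prod.swap)) (at (w, z))"
    using holomorphic2_on_has_derivative[OF assms \<open>(z, w) \<in> U\<close>]
    by (intro diff_chain_at bounded_linear_imp_has_derivative bounded_linear_swap) simp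
  then have "((f \<circ> prod.swap) has_derivative
      (\<lambda>(h, k). partial_snd f (z, w) * h + partial_fst f (z, w) * k)) (at (w, z))"
    by (simp add: o_def case_prod_beta' add.commute)
  then show "\<exists>a b. (f \<circ> prod.swap has_derivative (\<lambda>(h, k). a * h + b * k)) (at q)"
    using q by blast
qed

lemma partial_snd_swap: "partial_snd (f \<circ> prod.swap) (z, w) = partial_fst f (w, z)"
  and partial_fst_swap: "partial_fst (f \<circ> prod.swap) (z, w) = partial_snd f (w, z)"
  by (simp_all add: partial_fst_def partial_snd_def)

lemma holomorphic2_on_const: "holomorphic2_on (\<lambda>_. c) U"
  unfolding holomorphic2_on_def by (auto intro!: exI[of _ 0] simp: case_prod_beta')

lemma holomorphic2_on_diff:
  assumes "holomorphic2_on f U" and "holomorphic2_on g U"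
  shows "holomorphic2_on (\<lambda>p. f p - g p) U"
  unfolding holomorphic2_on_def
proof
  fix p assume p: "p \<in> U"
  have "((\<lambda>p. f p - g p) has_derivative (\<lambda>(h, k).
      (partial_fst f p - partial_fst g p) * h + (partial_snd f p - partial_snd g p) * k)) (at p)"
    by (rule has_derivative_eq_rhs, rule has_derivative_diff)
      (use holomorphic2_on_has_derivative[OF assms(1) p] holomorphic2_on_has_derivative[OF assms(2) p]
        in \<open>auto simp: algebra_simps\<close>)
  then show "\<exists>a b. ((\<lambda>p. f p - g p) has_derivative (\<lambda>(h, k). a * h + b * k)) (at p)" by blast
qed

lemma holomorphic2_on_mult:
  assumes "holomorphic2_on f U" and "holomorphic2_on g U"
  shows "holomorphic2_on (\<lambda>p. f p * g p) U"
  unfolding holomorphic2_on_def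
proof
  fix p assume p: "p \<in> U"
  have "((\<lambda>p. f p * g p) has_derivative (\<lambda>(h, k).
      (f p * partial_fst g p + partial_fst f p * g p) * h
      + (f p * partial_snd g p + partial_snd f p * g p) * k)) (at p)"
    by (rule has_derivative_eq_rhs, rule has_derivative_mult)
      (use holomorphic2_on_has_derivative[OF assms(1) p] holomorphic2_on_has_derivative[OF assms(2) p]
        in \<open>auto simp: algebra_simps\<close>)
  then show "\<exists>a b. ((\<lambda>p. f p * g p) has_derivative (\<lambda>(h, k). a * h + b * k)) (at p)" by blast
qed

lemma holomorphic2_on_comp_graph:
  assumes "holomorphic2_on f U" and "(\<phi> has_field_derivative d) (at z)" and "(z, \<phi> z) \<in> U"
  shows "((\<lambda>x. f (x, \<phi> x)) has_field_derivative
    partial_fst f (z, \<phi> z) + partial_snd f (z, \<phi> z) * d) (at z)"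
proof -
  have "((f \<circ> (\<lambda>x. (x, \<phi> x))) has_derivative
      ((\<lambda>(h, k). partial_fst f (z, \<phi> z) * h + partial_snd f (z, \<phi> z) * k) \<circ> (\<lambda>h. (h, d * h)))) (at z)"
    using holomorphic2_on_has_derivative[OF assms(1,3)] assms(2)
    by (intro diff_chain_at has_derivative_Pair has_derivative_ident)
      (simp_all add: has_field_derivative_def)
  moreover have "(\<lambda>(h, k). partial_fst f (z, \<phi> z) * h + partial_snd f (z, \<phi> z) * k) \<circ> (\<lambda>h. (h, d * h))
      = (*) (partial_fst f (z, \<phi> z) + partial_snd f (z, \<phi> z) * d)"
    by (auto simp: algebra_simps)
  ultimately show ?thesis
    by (simp add: has_field_derivative_def o_def)
qed

text \<open>
  Below, radii are chosen so that a \<^emph>\<open>closed\<close> bidisc lies in the domain: Cauchy's formula needs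
  the boundary circle of the second factor, uniformly for all first coordinates in the first factor.
\<close>
lemma open_contains_bidisc:
  fixes U :: "(complex \<times> complex) set"
  assumes "open U" and "(z, w) \<in> U"
  obtains r where "r > 0" and "cball z r \<times> cball w r \<subseteq> U"
proof -
  obtain A B where AB: "open A" "open B" "z \<in> A" "w \<in> B" "A \<times> B \<subseteq> U"
    using assms by (metis mem_Times_iff open_prod_elim fst_conv snd_conv)
  obtain r s where "r > 0" "cball z r \<subseteq> A" "s > 0" "cball w s \<subseteq> B"
    using AB by (meson open_contains_cball)
  then have "min r s > 0" "cball z (min r s) \<times> cball w (min r s) \<subseteq> U"
    using AB(5) by (auto simp: subset_iff)
  then show thesis using that by blast
qed

definition separately_holomorphic_on where
  "separately_holomorphic_on f U \<longleftrightarrow> (\<forall>z w. (z, w) \<in> U \<longrightarrow>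
    (\<lambda>x. f (x, w)) field_differentiable at z \<and> (\<lambda>y. f (z, y)) field_differentiable at (w::complex))"

text \<open>
  Cauchy's formula in the second variable replaces the derivative by an integral over a fixed
  compact interval of values of \<open>f\<close> itself.  Both regularity results for \<open>partial_snd\<close>, continuity
  in \<open>(z, w)\<close> and holomorphy in \<open>z\<close>, then follow from theorems on parameter integrals.
\<close>
lemma partial_snd_Cauchy:
  assumes cont: "continuous_on U f" and sep: "separately_holomorphic_on f U"
    and U: "cball z\<^sub>0 r \<times> cball w\<^sub>0 r \<subseteq> U" and zw: "z \<in> cball z\<^sub>0 r" "w \<in> ball w\<^sub>0 r"
  shows "partial_snd f (z, w) = 1 / (2 * of_real pi * \<i>) * integral {0..1}
    (\<lambda>t. f (z, circlepath w\<^sub>0 r t) / (circlepath w\<^sub>0 r t - w)^2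
       * (2 * of_real pi * \<i> * of_real r * exp (2 * of_real pi * \<i> * t)))"
proof -
  have "continuous_on (cball w\<^sub>0 r) (\<lambda>y. f (z, y))"
    by (rule continuous_on_compose2[OF cont]) (use U zw in \<open>auto intro!: continuous_intros\<close>)
  moreover have "(\<lambda>y. f (z, y)) holomorphic_on ball w\<^sub>0 r"
  proof (rule holomorphic_onI)
    fix y assume "y \<in> ball w\<^sub>0 r"
    then have "(z, y) \<in> U" using U zw by auto
    then show "(\<lambda>y. f (z, y)) field_differentiable at y within ball w\<^sub>0 r"
      using sep by (auto simp: separately_holomorphic_on_def intro: field_differentiable_at_within)
  qed
  ultimately have "((\<lambda>y. f (z, y)) has_field_derivative (1 / (2 * of_real pi * \<i>)
      * contour_integral (circlepath w\<^sub>0 r) (\<lambda>u. f (z, u) / (u - w)^2))) (at w)"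
    by (rule Cauchy_derivative_integral_circlepath(2)) (use zw in auto)
  then have "partial_snd f (z, w) = 1 / (2 * of_real pi * \<i>)
      * contour_integral (circlepath w\<^sub>0 r) (\<lambda>u. f (z, u) / (u - w)^2)"
    by (simp add: partial_snd_def DERIV_imp_deriv)
  then show ?thesis
    by (simp only: contour_integral_integral vector_derivative_circlepath of_real_mult of_real_numeral)
qed

lemma circlepath_neq_inside:
  assumes "w \<in> ball w\<^sub>0 r"
  shows "circlepath w\<^sub>0 r t \<noteq> w"
  using assms by (auto simp: circlepath dist_norm norm_mult)

lemma circlepath_in_cball: "r > 0 \<Longrightarrow> circlepath w\<^sub>0 r t \<in> cball w\<^sub>0 r"
  by (simp add: circlepath dist_norm norm_mult)

lemma continuous_on_circlepath: "continuous_on A (circlepath w\<^sub>0 r)"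
  unfolding circlepath by (intro continuous_intros)

lemma continuous_on_partial_snd:
  assumes "open U" and cont: "continuous_on U f" and sep: "separately_holomorphic_on f U"
  shows "continuous_on U (partial_snd f)"
proof (rule continuous_at_imp_continuous_on, safe)
  fix z\<^sub>0 w\<^sub>0 assume "(z\<^sub>0, w\<^sub>0) \<in> U"
  then obtain r where r: "r > 0" "cball z\<^sub>0 r \<times> cball w\<^sub>0 r \<subseteq> U"
    using \<open>open U\<close> open_contains_bidisc by blast
  let ?B = "ball z\<^sub>0 r \<times> ball w\<^sub>0 r"
  have cc: "continuous_on A (\<lambda>x. circlepath w\<^sub>0 r (snd x))" for A :: "((complex \<times> complex) \<times> real) set"
    by (rule continuous_on_compose2[OF continuous_on_circlepath[of UNIV]]) (auto intro!: continuous_intros)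
  have cf: "continuous_on (?B \<times> cbox 0 1) (\<lambda>x. f (fst (fst x), circlepath w\<^sub>0 r (snd x)))"
  proof (rule continuous_on_compose2[OF cont])
    show "continuous_on (?B \<times> cbox 0 1) (\<lambda>x. (fst (fst x), circlepath w\<^sub>0 r (snd x)))"
      by (intro continuous_intros cc)
    show "(\<lambda>x. (fst (fst x), circlepath w\<^sub>0 r (snd x))) ` (?B \<times> cbox 0 1) \<subseteq> U"
      using circlepath_in_cball[OF r(1)] by (fastforce intro!: subsetD[OF r(2)])
  qed
  have "continuous_on ?B (\<lambda>p. integral (cbox 0 1)
      (\<lambda>t. f (fst p, circlepath w\<^sub>0 r t) / (circlepath w\<^sub>0 r t - snd p)^2
       * (2 * of_real pi * \<i> * of_real r * exp (2 * of_real pi * \<i> * t))))"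
    by (rule integral_continuous_on_param, unfold case_prod_beta)
      (intro continuous_intros cf cc; use circlepath_neq_inside in fastforce)
  then have "continuous_on ?B (\<lambda>p. 1 / (2 * of_real pi * \<i>) * integral {0..1}
      (\<lambda>t. f (fst p, circlepath w\<^sub>0 r t) / (circlepath w\<^sub>0 r t - snd p)^2
       * (2 * of_real pi * \<i> * of_real r * exp (2 * of_real pi * \<i> * t))))"
    by (intro continuous_intros) simp
  then have "continuous_on ?B (partial_snd f)"
    by (rule continuous_on_eq) (force simp: partial_snd_Cauchy[OF cont sep r(2)])
  then show "isCont (partial_snd f) (z\<^sub>0, w\<^sub>0)"
    by (rule continuous_on_interior) (use r(1) in \<open>simp add: interior_open open_Times\<close>)
qed

text \<open>
  Osgood's lemma.  A function with partial derivatives is differentiable at a point if one of the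
  partial derivatives is continuous there, and by Cauchy's formula \<open>partial_snd f\<close> is continuous as
  soon as \<open>f\<close> is continuous and separately holomorphic.
\<close>
lemma osgood_separately_holomorphic:
  assumes "open U" and cont: "continuous_on U f" and sep: "separately_holomorphic_on f U"
  shows "holomorphic2_on f U"
  unfolding holomorphic2_on_def
proof safe
  fix z w assume p: "(z, w) \<in> U"
  then obtain r where r: "r > 0" "cball z r \<times> cball w r \<subseteq> U"
    using \<open>open U\<close> open_contains_bidisc by blast
  let ?X = "ball z r" and ?Y = "ball w r"
  have inU: "(x, y) \<in> U" if "x \<in> ?X" "y \<in> ?Y" for x y using that r by auto
  have "((\<lambda>(x, y). f (x, y)) has_derivative
      (\<lambda>(h, k). partial_fst f (z, w) * h + blinfun_mult_right (partial_snd f (z, w)) k))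
      (at (z, w) within ?X \<times> ?Y)"
  proof (rule has_derivative_partialsI)
    show "((\<lambda>x. f (x, w)) has_derivative (*) (partial_fst f (z, w))) (at z within ?X)"
      using sep p by (auto simp: separately_holomorphic_on_def partial_fst_def
          simp flip: has_field_derivative_def
          intro!: has_field_derivative_at_within field_differentiable_derivI)
  next
    fix x y assume "x \<in> ?X" "y \<in> ?Y"
    then show "((\<lambda>y. f (x, y)) has_derivative blinfun_mult_right (partial_snd f (x, y)))
        (at y within ?Y)"
      using sep inU by (auto simp: separately_holomorphic_on_def partial_snd_def
          simp flip: has_field_derivative_def
          intro!: has_field_derivative_at_within field_differentiable_derivI)
  next
    have "continuous_on U (partial_snd f)" by (rule continuous_on_partial_snd) fact+
    then have "isCont (partial_snd f) (z, w)"
      using p \<open>open U\<close> by (simp add: continuous_on_eq_continuous_at)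
    then show "continuous (at (z, w) within ?X \<times> ?Y)
        (\<lambda>(x, y). blinfun_mult_right (partial_snd f (x, y)))"
      unfolding case_prod_beta prod.collapse
      by (rule continuous_at_imp_continuous_at_within
          [OF bounded_linear.continuous[OF bounded_linear_blinfun_mult_right]])
  qed (use r in auto)
  then show "\<exists>a b. (f has_derivative (\<lambda>(h, k). a * h + b * k)) (at (z, w))"
    using r(1) by (auto simp: at_within_open[of "(z, w)" "?X \<times> ?Y"] open_Times)
qed

lemma holomorphic2_on_imp_separately:
  "holomorphic2_on f U \<Longrightarrow> separately_holomorphic_on f U"
  unfolding separately_holomorphic_on_def field_differentiable_def
  using holomorphic2_on_slices by blast

lemma continuous_on_partial_fst:
  assumes "open U" and f: "holomorphic2_on f U"
  shows "continuous_on U (partial_fst f)"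
proof -
  have "open (prod.swap ` U)" using \<open>open U\<close> by (simp add: open_image_swap)
  then have "continuous_on (prod.swap ` U) (partial_snd (f \<circ> prod.swap))"
    by (intro continuous_on_partial_snd holomorphic2_on_imp_continuous_on
        holomorphic2_on_imp_separately holomorphic2_on_swap f)
  then have "continuous_on U (\<lambda>p. partial_snd (f \<circ> prod.swap) (prod.swap p))"
    by (rule continuous_on_compose2) (auto intro!: continuous_intros simp: prod.swap_def)
  then show ?thesis
    by (rule continuous_on_eq) (auto simp: partial_snd_swap)
qed

text \<open>
  The two-variable analogue of the fact that complex differentiability implies smoothness.  In the
  variable \<open>w\<close> it is the one-variable theorem; in the variable \<open>z\<close> one differentiates Cauchy's
  integral for \<open>partial_snd f\<close> under the integral sign.
\<close>
lemma holomorphic2_on_partial_snd: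
  assumes "open U" and f: "holomorphic2_on f U"
  shows "holomorphic2_on (partial_snd f) U"
proof (rule osgood_separately_holomorphic)
  note cont = holomorphic2_on_imp_continuous_on[OF f] and sep = holomorphic2_on_imp_separately[OF f]
  show "continuous_on U (partial_snd f)"
    by (rule continuous_on_partial_snd) fact+
  show "separately_holomorphic_on (partial_snd f) U"
    unfolding separately_holomorphic_on_def
  proof (intro allI impI conjI)
    fix z\<^sub>0 w\<^sub>0 assume "(z\<^sub>0, w\<^sub>0) \<in> U"
    then obtain r where r: "r > 0" "cball z\<^sub>0 r \<times> cball w\<^sub>0 r \<subseteq> U"
      using \<open>open U\<close> open_contains_bidisc by blast
    have "(z\<^sub>0, y) \<in> U" if "y \<in> ball w\<^sub>0 r" for y using that r by auto
    then have "(\<lambda>y. f (z\<^sub>0, y)) holomorphic_on ball w\<^sub>0 r"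
      using holomorphic2_on_slices(2)[OF f] by (subst holomorphic_on_open) blast+
    then have "deriv (\<lambda>y. f (z\<^sub>0, y)) holomorphic_on ball w\<^sub>0 r"
      by (intro holomorphic_deriv) auto
    then show "(\<lambda>y. partial_snd f (z\<^sub>0, y)) field_differentiable at w\<^sub>0"
      using r(1) by (simp add: partial_snd_def holomorphic_on_imp_differentiable_at[of _ "ball w\<^sub>0 r"])
    have cpath: "(x, circlepath w\<^sub>0 r t) \<in> U" if "x \<in> ball z\<^sub>0 r" for x t
      using that circlepath_in_cball[OF r(1)] by (intro subsetD[OF r(2)]) auto
    have "w\<^sub>0 \<in> ball w\<^sub>0 r" using r(1) by simp
    note ne = circlepath_neq_inside[OF this]
    let ?K = "\<lambda>t. 1 / (circlepath w\<^sub>0 r t - w\<^sub>0)^2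
         * (2 * of_real pi * \<i> * of_real r * exp (2 * of_real pi * \<i> * t))"
    have K: "continuous_on A ?K" for A
      by (intro continuous_intros continuous_on_circlepath) (use ne in simp)
    have "(\<lambda>x. integral (cbox 0 1) (\<lambda>t. f (x, circlepath w\<^sub>0 r t) * ?K t)) holomorphic_on ball z\<^sub>0 r"
    proof (rule leibniz_rule_holomorphic)
      fix x t assume "x \<in> ball z\<^sub>0 r"
      show "((\<lambda>x. f (x, circlepath w\<^sub>0 r t) * ?K t) has_field_derivative
          partial_fst f (x, circlepath w\<^sub>0 r t) * ?K t) (at x within ball z\<^sub>0 r)"
        by (rule has_field_derivative_at_within, rule DERIV_cmult_right,
            rule holomorphic2_on_slices[OF f], rule cpath) fact
    next
      fix x assume x: "x \<in> ball z\<^sub>0 r"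
      have "continuous_on (cbox 0 1) (\<lambda>t. f (x, circlepath w\<^sub>0 r t))"
        by (rule continuous_on_compose2[OF cont])
          (use cpath[OF x] in \<open>auto intro!: continuous_on_Pair continuous_on_circlepath\<close>)
      then show "(\<lambda>t. f (x, circlepath w\<^sub>0 r t) * ?K t) integrable_on cbox 0 1"
        by (intro integrable_continuous continuous_on_mult K)
    next
      have "continuous_on (ball z\<^sub>0 r \<times> cbox 0 1)
          (\<lambda>p. partial_fst f (fst p, circlepath w\<^sub>0 r (snd p)))"
        by (rule continuous_on_compose2[OF continuous_on_partial_fst[OF \<open>open U\<close> f]])
          (use cpath in \<open>auto intro!: continuous_on_Pair continuous_on_fst continuous_on_id
            continuous_on_compose2[OF continuous_on_circlepath[of UNIV] continuous_on_snd[OF continuous_on_id]]\<close>)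
      moreover have "continuous_on (ball z\<^sub>0 r \<times> cbox 0 1) (\<lambda>p. ?K (snd p))"
        by (rule continuous_on_compose2[OF K[of UNIV]]) (auto intro!: continuous_intros)
      ultimately show "continuous_on (ball z\<^sub>0 r \<times> cbox 0 1)
          (\<lambda>(x, t). partial_fst f (x, circlepath w\<^sub>0 r t) * ?K t)"
        unfolding case_prod_beta by (rule continuous_on_mult)
    qed auto
    then have "(\<lambda>x. 1 / (2 * of_real pi * \<i>) *
        integral (cbox 0 1) (\<lambda>t. f (x, circlepath w\<^sub>0 r t) * ?K t)) holomorphic_on ball z\<^sub>0 r"
      by (intro holomorphic_intros) auto
    then have "(\<lambda>x. partial_snd f (x, w\<^sub>0)) holomorphic_on ball z\<^sub>0 r"
    proof (rule holomorphic_transform)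
      fix x assume "x \<in> ball z\<^sub>0 r"
      then have "x \<in> cball z\<^sub>0 r" by simp
      from partial_snd_Cauchy[OF cont sep r(2) this \<open>w\<^sub>0 \<in> ball w\<^sub>0 r\<close>]
      show "1 / (2 * of_real pi * \<i>) *
          integral (cbox 0 1) (\<lambda>t. f (x, circlepath w\<^sub>0 r t) * ?K t) = partial_snd f (x, w\<^sub>0)"
        by (simp only: cbox_interval divide_inverse mult.assoc mult_1_left)
    qed
    then show "(\<lambda>x. partial_snd f (x, w\<^sub>0)) field_differentiable at z\<^sub>0"
      using r(1) by (simp add: holomorphic_on_imp_differentiable_at[of _ "ball z\<^sub>0 r"])
  qed
qed fact

lemma holomorphic2_on_partial_fst:
  assumes "open U" and f: "holomorphic2_on f U"
  shows "holomorphic2_on (partial_fst f) U"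
proof -
  have "open (prod.swap ` U)" using \<open>open U\<close> by (simp add: open_image_swap)
  then have "holomorphic2_on (partial_snd (f \<circ> prod.swap) \<circ> prod.swap) (prod.swap ` prod.swap ` U)"
    by (intro holomorphic2_on_swap holomorphic2_on_partial_snd f)
  moreover have "partial_snd (f \<circ> prod.swap) \<circ> prod.swap = partial_fst f"
    by (auto simp: fun_eq_iff partial_snd_swap)
  ultimately show ?thesis by (simp add: image_image)
qed

section \<open>The implicit function theorem\<close>

text \<open>
  Near a zero at which \<open>E\<^sub>w \<noteq> 0\<close> the zero set of \<open>E\<close> is the graph of a holomorphic function.
  The inverse function theorem applies to \<open>(z, w) \<mapsto> (z, E (z, w))\<close>; the inverse map \<open>g\<close> restricted to
  \<open>{(z, 0)}\<close> parametrizes the zero set, and its derivative is complex linear because the inverse of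
  a complex linear map is.  The neighbourhood \<open>W\<close> records that there are no further zeros near
  \<open>(z\<^sub>0, w\<^sub>0)\<close>.
\<close>
lemma implicit_function_snd:
  assumes "open U" and E: "holomorphic2_on E U" and p: "(z\<^sub>0, w\<^sub>0) \<in> U"
    and "E (z\<^sub>0, w\<^sub>0) = 0" and "partial_snd E (z\<^sub>0, w\<^sub>0) \<noteq> 0"
  obtains N \<phi> W where "open N" "z\<^sub>0 \<in> N" "\<phi> z\<^sub>0 = w\<^sub>0" "\<phi> holomorphic_on N"
    "\<forall>z\<in>N. (z, \<phi> z) \<in> U \<and> E (z, \<phi> z) = 0"
    "open W" "(z\<^sub>0, w\<^sub>0) \<in> W" "W \<subseteq> U"
    "\<forall>z w. (z, w) \<in> W \<longrightarrow> E (z, w) = 0 \<longrightarrow> w = \<phi> z"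
proof -
  define F where "F = (\<lambda>p. (fst p, E p))"
  define F' where "F' p = (\<lambda>q. (fst q, partial_fst E p * fst q + partial_snd E p * snd q))" for p
  define G' where "G' p = (\<lambda>q. (fst q, (snd q - partial_fst E p * fst q) / partial_snd E p))" for p
  define U1 where "U1 = {p \<in> U. partial_snd E p \<noteq> 0}"
  have bF: "bounded_linear (F' p)" for p
    unfolding F'_def by (intro bounded_linear_intros)
  have bG: "bounded_linear (G' p)" for p
    unfolding G'_def divide_inverse by (intro bounded_linear_intros)
  have csnd: "continuous_on U (partial_snd E)" and cfst: "continuous_on U (partial_fst E)"
    using \<open>open U\<close> E by (simp_all add: continuous_on_partial_fst holomorphic2_on_partial_snd
        holomorphic2_on_imp_continuous_on)
  then have "open (U \<inter> partial_snd E -` (- {0}))"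
    using \<open>open U\<close> by (intro continuous_open_preimage) auto
  moreover have "U \<inter> partial_snd E -` (- {0}) = U1" by (auto simp: U1_def)
  ultimately have "open U1" by simp
  have FG: "G' p \<circ> F' p = id" if "p \<in> U1" for p
    using that by (auto simp: F'_def G'_def U1_def fun_eq_iff)
  have derF: "(F has_derivative F' p) (at p)" if "p \<in> U1" for p
    using holomorphic2_on_has_derivative[OF E, of p] that unfolding F_def F'_def
    by (intro has_derivative_Pair has_derivative_fst has_derivative_ident)
      (auto simp: U1_def case_prod_beta')
  have contF': "continuous_on U1 (\<lambda>p. Blinfun (F' p))"
  proof (rule continuous_on_blinfun_componentwise)
    fix i :: "complex \<times> complex"
    have "continuous_on U1 (\<lambda>p. (fst i, partial_fst E p * fst i + partial_snd E p * snd i))"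
      using cfst csnd
      by (intro continuous_intros) (auto simp: U1_def elim: continuous_on_subset)
    then show "continuous_on U1 (\<lambda>p. blinfun_apply (Blinfun (F' p)) i)"
      by (simp add: bounded_linear_Blinfun_apply[OF bF]) (simp add: F'_def)
  qed
  have p1: "(z\<^sub>0, w\<^sub>0) \<in> U1" using assms by (simp add: U1_def)
  have "Blinfun (G' (z\<^sub>0, w\<^sub>0)) o\<^sub>L Blinfun (F' (z\<^sub>0, w\<^sub>0)) = id_blinfun"
    using fun_cong[OF FG[OF p1]]
    by (intro blinfun_eqI) (simp add: bounded_linear_Blinfun_apply bF bG)
  then obtain W V g where W: "open W" "W \<subseteq> U1" "(z\<^sub>0, w\<^sub>0) \<in> W" and V: "open V"
    and hom: "homeomorphism W V F g"
    using inverse_function_theorem[of U1 F "\<lambda>p. Blinfun (F' p)"] \<open>open U1\<close> derF contF' p1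
    by (metis bF bounded_linear_Blinfun_apply)
  define N where "N = {z. (z, 0) \<in> V}"
  define \<phi> where "\<phi> z = snd (g (z, 0))" for z
  have gN: "g (z, 0) = (z, \<phi> z) \<and> (z, \<phi> z) \<in> W \<and> E (z, \<phi> z) = 0" if "z \<in> N" for z
  proof -
    have "F (g (z, 0)) = (z, 0)" "g (z, 0) \<in> W"
      using that hom by (auto simp: N_def homeomorphism_def)
    then show ?thesis by (auto simp: F_def \<phi>_def prod_eq_iff) (metis prod.collapse)+
  qed
  have loc: "z \<in> N \<and> w = \<phi> z" if "(z, w) \<in> W" "E (z, w) = 0" for z w
  proof -
    have "F (z, w) = (z, 0)" using that by (simp add: F_def)
    moreover have "F (z, w) \<in> V" "g (F (z, w)) = (z, w)"
      using that hom unfolding homeomorphism_def by blast+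
    ultimately show ?thesis by (simp add: N_def \<phi>_def)
  qed
  have "open N"
  proof -
    have "open ((\<lambda>z. (z, 0::complex)) -` V)"
      by (rule open_vimage[OF V]) (intro continuous_intros)
    then show ?thesis by (simp add: N_def vimage_def)
  qed
  have "\<phi> field_differentiable at z" if z: "z \<in> N" for z
  proof -
    have gz: "g (z, 0) = (z, \<phi> z)" "g (z, 0) \<in> U1" using gN[OF z] W(2) by auto
    have "(g has_derivative G' (g (z, 0))) (at (z, 0))"
    proof (rule has_derivative_inverse_basic)
      show "(F has_derivative F' (g (z, 0))) (at (g (z, 0)))" using derF gz by simp
      show "isCont g (z, 0)"
        using hom z V by (auto simp: homeomorphism_def N_def continuous_on_eq_continuous_at)
      show "F (g y) = y" if "y \<in> V" for y using that hom by (simp add: homeomorphism_def)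
    qed (use V z bG FG[OF gz(2)] in \<open>auto simp: N_def\<close>)
    then have "((snd \<circ> g \<circ> (\<lambda>z. (z, 0))) has_derivative
        (snd \<circ> G' (z, \<phi> z) \<circ> (\<lambda>h. (h, 0)))) (at z)"
      unfolding gz(1) by (intro diff_chain_at has_derivative_Pair has_derivative_ident
          has_derivative_const has_derivative_snd) (auto intro: bounded_linear_imp_has_derivative bounded_linear_snd)
    moreover have "snd \<circ> G' (z, \<phi> z) \<circ> (\<lambda>h. (h, 0))
        = (*) (- partial_fst E (z, \<phi> z) / partial_snd E (z, \<phi> z))"
      by (auto simp: G'_def)
    moreover have "snd \<circ> g \<circ> (\<lambda>z. (z, 0)) = \<phi>" by (auto simp: \<phi>_def)
    ultimately show ?thesis
      unfolding field_differentiable_def has_field_derivative_def by metis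
  qed
  then have hol: "\<phi> holomorphic_on N"
    by (simp add: holomorphic_onI field_differentiable_at_within)
  show thesis
    by (rule that[of N \<phi> W]) (use loc[of z\<^sub>0 w\<^sub>0] loc gN W hol \<open>open N\<close> assms(4) in \<open>auto simp: U1_def\<close>)
qed

section \<open>Injective holomorphic maps are locally biholomorphic\<close>

definition jacobian2 where
  "jacobian2 f g p = partial_fst f p * partial_snd g p - partial_snd f p * partial_fst g p"

text \<open>
  If \<open>f\<^sub>w \<noteq> 0\<close>, the level set of \<open>f\<close> through \<open>p\<close> is a graph \<open>w = \<phi> z\<close>.  Injectivity of \<open>(f, g)\<close> makes
  \<open>z \<mapsto> g (z, \<phi> z)\<close> injective, so in one variable its derivative does not vanish.  That derivative
  is \<open>g\<^sub>z + g\<^sub>w \<phi>'\<close>, which differs from the Jacobian determinant by the factor \<open>- f\<^sub>w\<close>, since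
  \<open>f\<^sub>z + f\<^sub>w \<phi>' = 0\<close>.
\<close>
lemma jacobian2_nonzero_if_partial_snd_nonzero:
  assumes "open U" and f: "holomorphic2_on f U" and g: "holomorphic2_on g U"
    and inj: "inj_on (\<lambda>p. (f p, g p)) U" and p: "p \<in> U" and nz: "partial_snd f p \<noteq> 0"
  shows "jacobian2 f g p \<noteq> 0"
proof -
  obtain z\<^sub>0 w\<^sub>0 where p_eq: "p = (z\<^sub>0, w\<^sub>0)" by force
  let ?E = "\<lambda>q. f q - f p"
  have E: "holomorphic2_on ?E U" by (intro holomorphic2_on_diff f holomorphic2_on_const)
  have "((\<lambda>y. ?E (z\<^sub>0, y)) has_field_derivative partial_snd f p) (at w\<^sub>0)"
    using holomorphic2_on_slices(2)[OF f, of z\<^sub>0 w\<^sub>0] p unfolding p_eq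
    by (auto intro!: derivative_eq_intros)
  then have nzE: "partial_snd ?E (z\<^sub>0, w\<^sub>0) \<noteq> 0"
    using nz by (auto simp: partial_snd_def dest!: DERIV_imp_deriv)
  have "(z\<^sub>0, w\<^sub>0) \<in> U" "?E (z\<^sub>0, w\<^sub>0) = 0" using p p_eq by auto
  then obtain N \<phi> where N: "open N" "z\<^sub>0 \<in> N" "\<phi> z\<^sub>0 = w\<^sub>0" "\<phi> holomorphic_on N"
    and graph: "\<forall>z\<in>N. (z, \<phi> z) \<in> U \<and> ?E (z, \<phi> z) = 0"
    by (rule implicit_function_snd[OF \<open>open U\<close> E _ _ nzE])
  then have U: "(z, \<phi> z) \<in> U" and f0: "f (z, \<phi> z) = f p" if "z \<in> N" for z
    using that by auto
  have \<phi>: "(\<phi> has_field_derivative deriv \<phi> z) (at z)" if "z \<in> N" for z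
    using N that by (simp add: holomorphic_derivI)
  note derf = holomorphic2_on_comp_graph[OF f \<phi> U] and derg = holomorphic2_on_comp_graph[OF g \<phi> U]
  have "((\<lambda>z. f (z, \<phi> z)) has_field_derivative 0) (at z\<^sub>0)"
    by (rule has_field_derivative_transform_within_open[of "\<lambda>_. f p" _ _ N]) (use N f0 in auto)
  from DERIV_unique[OF derf[OF N(2,2)] this] N(3) p_eq
  have 1: "partial_fst f p + partial_snd f p * deriv \<phi> z\<^sub>0 = 0" by simp
  have "inj_on (\<lambda>z. g (z, \<phi> z)) N"
  proof (rule inj_onI)
    fix x y assume xy: "x \<in> N" "y \<in> N" "g (x, \<phi> x) = g (y, \<phi> y)"
    then have "(x, \<phi> x) = (y, \<phi> y)"
      by - (rule inj_onD[OF inj], simp_all add: f0 U)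
    then show "x = y" by simp
  qed
  moreover have "(\<lambda>z. g (z, \<phi> z)) holomorphic_on N"
    using derg N(1) by (subst holomorphic_on_open) blast+
  ultimately have "deriv (\<lambda>z. g (z, \<phi> z)) z\<^sub>0 \<noteq> 0"
    by (intro holomorphic_injective_imp_regular[where S = N] N)
  then have "partial_fst g p + partial_snd g p * deriv \<phi> z\<^sub>0 \<noteq> 0"
    using DERIV_imp_deriv[OF derg[OF N(2,2)]] N(3) p_eq by simp
  moreover have "jacobian2 f g p = - partial_snd f p * (partial_fst g p + partial_snd g p * deriv \<phi> z\<^sub>0)
      + (partial_fst f p + partial_snd f p * deriv \<phi> z\<^sub>0) * partial_snd g p"
    by (simp add: jacobian2_def algebra_simps)
  ultimately show ?thesis using 1 nz by simp
qed

text \<open>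
  For an injective map the Jacobian matrix therefore never has rank one: exchanging the two
  components or the two variables covers the case that any entry is nonzero.
\<close>
lemma partials_zero_if_jacobian2_zero:
  assumes "open U" and f: "holomorphic2_on f U" and g: "holomorphic2_on g U"
    and inj: "inj_on (\<lambda>p. (f p, g p)) U" and p: "p \<in> U" and J: "jacobian2 f g p = 0"
  shows "partial_fst f p = 0" "partial_snd f p = 0" "partial_fst g p = 0" "partial_snd g p = 0"
proof -
  have inj': "inj_on (\<lambda>p. (g p, f p)) U" using inj by (auto simp: inj_on_def)
  have J': "jacobian2 g f p = 0" using J by (simp add: jacobian2_def algebra_simps)
  show "partial_snd f p = 0" "partial_snd g p = 0"
    using jacobian2_nonzero_if_partial_snd_nonzero[OF \<open>open U\<close> f g inj p]
      jacobian2_nonzero_if_partial_snd_nonzero[OF \<open>open U\<close> g f inj' p] J J' by auto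
  let ?U = "prod.swap ` U" and ?f = "f \<circ> prod.swap" and ?g = "g \<circ> prod.swap"
  have U: "open ?U" and p': "prod.swap p \<in> ?U" using \<open>open U\<close> p by (auto simp: open_image_swap)
  have sf: "partial_snd (h \<circ> prod.swap) (prod.swap p) = partial_fst h p"
    "partial_fst (h \<circ> prod.swap) (prod.swap p) = partial_snd h p" for h
    by (cases p, simp only: swap_simp partial_snd_swap partial_fst_swap)+
  have "jacobian2 ?f ?g (prod.swap p) = 0" "jacobian2 ?g ?f (prod.swap p) = 0"
    using J by (simp_all add: jacobian2_def sf algebra_simps)
  moreover have "inj_on (\<lambda>p. (?f p, ?g p)) ?U" "inj_on (\<lambda>p. (?g p, ?f p)) ?U"
    using inj by (auto simp: inj_on_def)
  ultimately show "partial_fst f p = 0" "partial_fst g p = 0"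
    using jacobian2_nonzero_if_partial_snd_nonzero[OF U _ _ _ p', of ?f ?g]
      jacobian2_nonzero_if_partial_snd_nonzero[OF U _ _ _ p', of ?g ?f]
      holomorphic2_on_swap[OF f] holomorphic2_on_swap[OF g] sf by auto
qed

text \<open>
  Up to factorials the iterated partial derivatives are the Taylor coefficients of the vertical
  slice \<open>D (z, _)\<close>; this gives access to the identity theorem in one variable.
\<close>
lemma iterated_partial_snd: "(partial_snd ^^ n) D (z, w) = (deriv ^^ n) (\<lambda>y. D (z, y)) w"
proof (induction n arbitrary: w)
  case (Suc n)
  have "(\<lambda>y. (partial_snd ^^ n) D (z, y)) = (deriv ^^ n) (\<lambda>y. D (z, y))"
    using Suc by (simp add: fun_eq_iff)
  then show ?case by (simp add: partial_snd_def[of "(partial_snd ^^ n) D"])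
qed simp

lemma holomorphic2_on_iterated_partial_snd:
  "open U \<Longrightarrow> holomorphic2_on D U \<Longrightarrow> holomorphic2_on ((partial_snd ^^ n) D) U"
  by (induction n) (auto intro: holomorphic2_on_partial_snd)

lemma holomorphic_on_vertical_slice:
  assumes "holomorphic2_on f U" and "open B" and "\<And>y. y \<in> B \<Longrightarrow> (z, y) \<in> U"
  shows "(\<lambda>y. f (z, y)) holomorphic_on B"
  using holomorphic2_on_slices(2)[OF assms(1)] assms(2,3) by (subst holomorphic_on_open) blast+

text \<open>
  Hurwitz's theorem in the form needed here: a zero of the slice \<open>D (z\<^sub>0, _)\<close> cannot disappear for
  all \<open>z \<noteq> z\<^sub>0\<close> near \<open>z\<^sub>0\<close>, unless that slice is constant.
\<close>
lemma zeros_persist: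
  assumes D: "holomorphic2_on D U" and bidisc: "cball z\<^sub>0 r \<times> cball w\<^sub>0 r \<subseteq> U" and "r > 0"
    and zero: "D (z\<^sub>0, w\<^sub>0) = 0"
    and nonzero: "\<And>z w. z \<in> cball z\<^sub>0 r \<Longrightarrow> z \<noteq> z\<^sub>0 \<Longrightarrow> w \<in> ball w\<^sub>0 r \<Longrightarrow> D (z, w) \<noteq> 0"
  shows "(\<lambda>y. D (z\<^sub>0, y)) constant_on ball w\<^sub>0 r"
proof (rule ccontr)
  assume nonconst: "\<not> (\<lambda>y. D (z\<^sub>0, y)) constant_on ball w\<^sub>0 r"
  \<comment> \<open>A sequence of parameters other than \<open>z\<^sub>0\<close> in the disc of radius \<open>r\<close> that converges to \<open>z\<^sub>0\<close>.\<close>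
  define \<zeta> where "\<zeta> n = z\<^sub>0 + of_real (r / (real n + 2))" for n
  have \<zeta>: "\<zeta> n \<in> cball z\<^sub>0 r" "\<zeta> n \<noteq> z\<^sub>0" for n
    using \<open>r > 0\<close> by (auto simp: \<zeta>_def dist_norm norm_divide field_simps simp flip: of_real_add)
  have lim: "\<zeta> \<longlonglongrightarrow> z\<^sub>0"
  proof -
    have "(\<lambda>n. r / (real n + 2)) \<longlonglongrightarrow> 0" by real_asymp
    then have "(\<lambda>n. z\<^sub>0 + of_real (r / (real n + 2))) \<longlonglongrightarrow> z\<^sub>0 + of_real 0"
      by (intro tendsto_intros)
    then show ?thesis by (simp add: \<zeta>_def[abs_def])
  qed
  have slice: "(\<lambda>y. D (z, y)) holomorphic_on ball w\<^sub>0 r" if "z \<in> cball z\<^sub>0 r" for z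
    by (rule holomorphic_on_vertical_slice[OF D]) (use bidisc that in auto)
  have "D (z\<^sub>0, w\<^sub>0) \<noteq> 0"
  proof (rule Hurwitz_no_zeros[of "ball w\<^sub>0 r" "\<lambda>n y. D (\<zeta> n, y)" "\<lambda>y. D (z\<^sub>0, y)"])
    fix K :: "complex set" assume K: "compact K" "K \<subseteq> ball w\<^sub>0 r"
    have sub: "cball z\<^sub>0 r \<times> K \<subseteq> U" using K(2) bidisc by force
    have "uniformly_continuous_on (cball z\<^sub>0 r \<times> K) D"
      using K(1) by (intro compact_uniformly_continuous compact_Times compact_cball
          continuous_on_subset[OF holomorphic2_on_imp_continuous_on[OF D] sub])
    show "uniform_limit K (\<lambda>n y. D (\<zeta> n, y)) (\<lambda>y. D (z\<^sub>0, y)) sequentially"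
    proof (rule uniform_limitI)
      fix e :: real assume "e > 0"
      then obtain d where "d > 0" and d: "\<And>p q. p \<in> cball z\<^sub>0 r \<times> K \<Longrightarrow> q \<in> cball z\<^sub>0 r \<times> K \<Longrightarrow>
          dist p q < d \<Longrightarrow> dist (D p) (D q) < e"
        using \<open>uniformly_continuous_on (cball z\<^sub>0 r \<times> K) D\<close>
        unfolding uniformly_continuous_on_def by metis
      have "\<forall>\<^sub>F n in sequentially. dist (\<zeta> n) z\<^sub>0 < d"
        using lim \<open>d > 0\<close> by (rule tendstoD)
      then show "\<forall>\<^sub>F n in sequentially. \<forall>y\<in>K. dist (D (\<zeta> n, y)) (D (z\<^sub>0, y)) < e"
        by (rule eventually_mono) (use \<zeta>(1) \<open>r > 0\<close> in \<open>auto intro!: d simp: dist_Pair_Pair\<close>)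
    qed
  qed (use slice \<zeta> nonzero nonconst \<open>r > 0\<close> in auto)
  with zero show False by simp
qed

lemma zero_derivative_imp_equal:
  assumes "\<And>x. x \<in> ball a r \<Longrightarrow> (h has_field_derivative (0::complex)) (at x)"
    and "x \<in> ball a r" and "y \<in> ball a r"
  shows "h x = h y"
proof -
  have "\<exists>c. \<forall>x\<in>ball a r. h x = c"
    by (rule has_field_derivative_zero_constant[OF convex_ball
          has_field_derivative_at_within[OF assms(1)]])
  then show ?thesis using assms(2,3) by auto
qed

text \<open>
  Osgood's theorem on injective holomorphic maps.  Let \<open>Z\<close> be the zero set of the Jacobian
  determinant \<open>D\<close>.  At points of \<open>Z\<close> all partial derivatives of \<open>f\<close> and \<open>g\<close> vanish, so \<open>(f, g)\<close> is constant
  along every holomorphic curve in \<open>Z\<close>; by injectivity, \<open>Z\<close> contains no graph over a disc, neither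
  over the first nor over the second coordinate.  But if \<open>Z\<close> were nonempty, it would contain one.
  The vanishing order of \<open>D\<close> in the direction of \<open>w\<close> is finite on \<open>Z\<close>, as \<open>Z\<close> contains no vertical disc.  Let
  it be minimal, equal to \<open>m = k + 1\<close>, at \<open>(z\<^sub>0, w\<^sub>0)\<close>.  By minimality \<open>E = \<partial>\<^sub>w\<^sup>k D\<close> vanishes on all of \<open>Z\<close>, whereas
  \<open>E\<^sub>w \<noteq> 0\<close> at \<open>(z\<^sub>0, w\<^sub>0)\<close>.  So near this point \<open>Z\<close> is contained in the graph of some \<open>\<phi>\<close>.  If \<open>D\<close> did not vanish
  along the whole graph, the zero \<open>(z\<^sub>0, w\<^sub>0)\<close> of \<open>D\<close> would be isolated on it and hence isolated in \<open>Z\<close>, which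
  Hurwitz's theorem excludes.
\<close>
theorem jacobian2_nonzero_if_injective:
  assumes "open U" and f: "holomorphic2_on f U" and g: "holomorphic2_on g U"
    and inj: "inj_on (\<lambda>p. (f p, g p)) U" and "p \<in> U"
  shows "jacobian2 f g p \<noteq> 0"
proof
  assume "jacobian2 f g p = 0"
  define D where "D = jacobian2 f g"
  have D: "holomorphic2_on D U"
    unfolding D_def jacobian2_def[abs_def]
    by (intro holomorphic2_on_diff holomorphic2_on_mult holomorphic2_on_partial_fst
        holomorphic2_on_partial_snd f g \<open>open U\<close>)
  note crit = partials_zero_if_jacobian2_zero[OF \<open>open U\<close> f g inj, folded D_def]
  \<comment> \<open>\<open>Z\<close> contains no graph over a disc in the first coordinate.\<close>
  have no_curve: False
    if "r > 0" and \<phi>: "\<And>z. z \<in> ball z\<^sub>0 r \<Longrightarrow> \<phi> field_differentiable at z"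
      and Z: "\<And>z. z \<in> ball z\<^sub>0 r \<Longrightarrow> (z, \<phi> z) \<in> U \<and> D (z, \<phi> z) = 0" for z\<^sub>0 r \<phi>
  proof -
    have der: "((\<lambda>x. f (x, \<phi> x)) has_field_derivative 0) (at z)"
      "((\<lambda>x. g (x, \<phi> x)) has_field_derivative 0) (at z)" if z: "z \<in> ball z\<^sub>0 r" for z
      using holomorphic2_on_comp_graph[OF f, of \<phi> "deriv \<phi> z" z]
        holomorphic2_on_comp_graph[OF g, of \<phi> "deriv \<phi> z" z] crit[of "(z, \<phi> z)"] Z[OF z] \<phi>[OF z]
      by (simp_all add: field_differentiable_derivI)
    define z\<^sub>1 where "z\<^sub>1 = z\<^sub>0 + of_real (r / 2)"
    have z01: "z\<^sub>0 \<in> ball z\<^sub>0 r" "z\<^sub>1 \<in> ball z\<^sub>0 r" "z\<^sub>1 \<noteq> z\<^sub>0"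
      using \<open>r > 0\<close> by (auto simp: z\<^sub>1_def dist_norm)
    have "f (z\<^sub>0, \<phi> z\<^sub>0) = f (z\<^sub>1, \<phi> z\<^sub>1)" "g (z\<^sub>0, \<phi> z\<^sub>0) = g (z\<^sub>1, \<phi> z\<^sub>1)"
      using zero_derivative_imp_equal[OF der(1) z01(1,2)] zero_derivative_imp_equal[OF der(2) z01(1,2)]
      by auto
    then have "(z\<^sub>0, \<phi> z\<^sub>0) = (z\<^sub>1, \<phi> z\<^sub>1)"
      using Z z01 by - (rule inj_onD[OF inj], simp_all)
    then show False using z01(3) by simp
  qed
  \<comment> \<open>\<open>Z\<close> contains no vertical disc.\<close>
  have finite_order: "\<exists>n. (partial_snd ^^ n) D q \<noteq> 0" if qU: "q \<in> U" and "D q = 0" for q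
  proof (rule ccontr)
    obtain z w where q: "q = (z, w)" by force
    assume "\<nexists>n. (partial_snd ^^ n) D q \<noteq> 0"
    then have all0: "(deriv ^^ n) (\<lambda>y. D (z, y)) w = 0" for n
      by (simp add: q flip: iterated_partial_snd)
    obtain r where r: "r > 0" "cball z r \<times> cball w r \<subseteq> U"
      using open_contains_bidisc[OF \<open>open U\<close> qU[unfolded q]] by blast
    then have inU: "(z, y) \<in> U" if "y \<in> ball w r" for y using that by auto
    have "(\<lambda>y. D (z, y)) holomorphic_on ball w r"
      by (rule holomorphic_on_vertical_slice[OF D]) (use inU in auto)
    then have D0: "D (z, y) = 0" if "y \<in> ball w r" for y
      using holomorphic_fun_eq_0_on_connected[of "\<lambda>y. D (z, y)" "ball w r" w y] all0 that r(1) by auto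
    have der: "((\<lambda>y. f (z, y)) has_field_derivative 0) (at y)"
      "((\<lambda>y. g (z, y)) has_field_derivative 0) (at y)" if "y \<in> ball w r" for y
      using holomorphic2_on_slices(2)[OF f inU[OF that]] holomorphic2_on_slices(2)[OF g inU[OF that]]
        crit[OF inU[OF that] D0[OF that]] by simp_all
    define y where "y = w + of_real (r / 2)"
    have y: "w \<in> ball w r" "y \<in> ball w r" "y \<noteq> w"
      using \<open>r > 0\<close> by (auto simp: y_def dist_norm)
    have "f (z, w) = f (z, y)" "g (z, w) = g (z, y)"
      using zero_derivative_imp_equal[OF der(1) y(1,2)] zero_derivative_imp_equal[OF der(2) y(1,2)]
      by auto
    then have "(z, w) = (z, y)"
      using inU y by - (rule inj_onD[OF inj], simp_all)
    then show False using y(3) by simp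
  qed
  define nonvanishing_on_Z where
    "nonvanishing_on_Z n \<longleftrightarrow> (\<exists>q\<in>U. D q = 0 \<and> (partial_snd ^^ n) D q \<noteq> 0)" for n
  define m where "m = (LEAST n. nonvanishing_on_Z n)"
  have "\<exists>n. nonvanishing_on_Z n"
    using finite_order[OF \<open>p \<in> U\<close>] \<open>jacobian2 f g p = 0\<close> \<open>p \<in> U\<close> by (auto simp: nonvanishing_on_Z_def D_def)
  then have "nonvanishing_on_Z m" unfolding m_def by (rule LeastI_ex)
  then obtain z\<^sub>0 w\<^sub>0 where q: "(z\<^sub>0, w\<^sub>0) \<in> U" "D (z\<^sub>0, w\<^sub>0) = 0" "(partial_snd ^^ m) D (z\<^sub>0, w\<^sub>0) \<noteq> 0"
    by (auto simp: nonvanishing_on_Z_def)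
  \<comment> \<open>The order is positive because \<open>D\<close> itself vanishes on \<open>Z\<close>.\<close>
  then obtain k where k: "m = Suc k" by (cases m) auto
  define E where "E = (partial_snd ^^ k) D"
  have E: "holomorphic2_on E U"
    unfolding E_def by (rule holomorphic2_on_iterated_partial_snd) fact+
  have EZ: "E q = 0" if "q \<in> U" "D q = 0" for q
    using not_less_Least[of k nonvanishing_on_Z] that k by (auto simp: E_def nonvanishing_on_Z_def m_def)
  have nzE: "partial_snd E (z\<^sub>0, w\<^sub>0) \<noteq> 0" using q(3) by (simp add: E_def k)
  obtain N \<phi> W where N: "open N" "z\<^sub>0 \<in> N" "\<phi> z\<^sub>0 = w\<^sub>0" "\<phi> holomorphic_on N"
    and graph: "\<forall>z\<in>N. (z, \<phi> z) \<in> U \<and> E (z, \<phi> z) = 0"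
    and W: "open W" "(z\<^sub>0, w\<^sub>0) \<in> W" "W \<subseteq> U"
    and loc: "\<forall>z w. (z, w) \<in> W \<longrightarrow> E (z, w) = 0 \<longrightarrow> w = \<phi> z"
    by (rule implicit_function_snd[OF \<open>open U\<close> E q(1) EZ[OF q(1,2)] nzE])
  then have inU: "(z, \<phi> z) \<in> U" if "z \<in> N" for z using that by blast
  obtain \<delta> where \<delta>: "\<delta> > 0" "ball z\<^sub>0 \<delta> \<subseteq> N"
    using N(1,2) open_contains_ball by blast
  have \<phi>': "\<phi> field_differentiable at z" if "z \<in> ball z\<^sub>0 \<delta>" for z
    using N(1,4) \<delta>(2) that holomorphic_on_imp_differentiable_at by blast
  have "\<exists>z\<in>ball z\<^sub>0 \<delta>. D (z, \<phi> z) \<noteq> 0"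
    using no_curve[OF \<delta>(1) \<phi>'] inU \<delta>(2) by blast
  then obtain z\<^sub>1 where z\<^sub>1: "z\<^sub>1 \<in> ball z\<^sub>0 \<delta>" "D (z\<^sub>1, \<phi> z\<^sub>1) \<noteq> 0" by blast
  have hol: "(\<lambda>z. D (z, \<phi> z)) holomorphic_on ball z\<^sub>0 \<delta>"
    using holomorphic2_on_comp_graph[OF D field_differentiable_derivI[OF \<phi>'] inU] \<delta>(2)
    by (subst holomorphic_on_open) blast+
  have "z\<^sub>0 \<in> ball z\<^sub>0 \<delta>" "D (z\<^sub>0, \<phi> z\<^sub>0) = 0" using \<delta>(1) N(3) q(2) by auto
  then obtain s where s: "s > 0" "\<And>z. z \<in> ball z\<^sub>0 s - {z\<^sub>0} \<Longrightarrow> D (z, \<phi> z) \<noteq> 0"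
    using isolated_zeros[OF hol open_ball connected_ball _ _ z\<^sub>1] by metis
  \<comment> \<open>A bidisc in which \<open>Z\<close> lies on the graph, over a disc in which \<open>D\<close> vanishes on the graph only
    at the centre.\<close>
  obtain e where e: "e > 0" "cball z\<^sub>0 e \<times> cball w\<^sub>0 e \<subseteq> W"
    using open_contains_bidisc[OF W(1,2)] by blast
  define r where "r = min (s / 2) e"
  have r: "r > 0" "cball z\<^sub>0 r \<times> cball w\<^sub>0 r \<subseteq> W" "cball z\<^sub>0 r \<subseteq> ball z\<^sub>0 s"
    using e s(1) by (auto simp: r_def subset_iff)
  have "(\<lambda>y. D (z\<^sub>0, y)) constant_on ball w\<^sub>0 r"
  proof (rule zeros_persist[OF D _ r(1) q(2)])
    show "cball z\<^sub>0 r \<times> cball w\<^sub>0 r \<subseteq> U" using r(2) W(3) by blast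
    fix z w assume z: "z \<in> cball z\<^sub>0 r" "z \<noteq> z\<^sub>0" "w \<in> ball w\<^sub>0 r"
    then have "(z, w) \<in> W" using r(2) by auto
    show "D (z, w) \<noteq> 0"
    proof
      assume "D (z, w) = 0"
      then have "w = \<phi> z" using loc EZ \<open>(z, w) \<in> W\<close> W(3) by blast
      then show False using s(2)[of z] z r(3) \<open>D (z, w) = 0\<close> by blast
    qed
  qed
  then have "\<And>y. y \<in> ball w\<^sub>0 r \<Longrightarrow> D (z\<^sub>0, y) = 0"
    using q(2) r(1) unfolding constant_on_def by (metis centre_in_ball)
  then have "(deriv ^^ m) (\<lambda>y. D (z\<^sub>0, y)) w\<^sub>0 = (deriv ^^ m) (\<lambda>_. 0) w\<^sub>0"
    by (intro higher_deriv_cong_ev eventually_nhds_in_open[THEN eventually_mono, of "ball w\<^sub>0 r"])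
      (use r(1) in auto)
  then show False using q(3) by (simp add: iterated_partial_snd)
qed

text \<open>
  With the Jacobian matrix known to be invertible, continuity of the inverse map \<open>K\<close> yields its
  differentiability, with the inverse matrix as derivative, which is again complex linear.
\<close>
theorem inverse_of_injective_holomorphic_map:
  assumes "open U" and "open V" and F: "holomorphic_map_on F U" and hom: "homeomorphism U V F K"
  shows "holomorphic_map_on K V"
proof -
  define f g where "f = fst \<circ> F" and "g = snd \<circ> F"
  have fg: "holomorphic2_on f U" "holomorphic2_on g U" and F_eq: "F = (\<lambda>p. (f p, g p))"
    using F by (auto simp: holomorphic_map_on_def f_def g_def)
  have "inj_on (\<lambda>p. (f p, g p)) U"
    using hom unfolding F_eq[symmetric] homeomorphism_def by (metis inj_on_inverseI)
  note J = jacobian2_nonzero_if_injective[OF \<open>open U\<close> fg this]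
  have "(\<exists>a b. (fst \<circ> K has_derivative (\<lambda>(h, k). a * h + b * k)) (at q)) \<and>
      (\<exists>a b. (snd \<circ> K has_derivative (\<lambda>(h, k). a * h + b * k)) (at q))" if q: "q \<in> V" for q
  proof -
    define p where "p = K q"
    have p: "p \<in> U" using hom q by (auto simp: p_def homeomorphism_def)
    define j where "j = jacobian2 f g p"
    have j: "j \<noteq> 0" using J[OF p] by (simp add: j_def)
    \<comment> \<open>Cramer's rule for the inverse of the Jacobian matrix.\<close>
    let ?G = "\<lambda>(h, k). (partial_snd g p / j * h + (- partial_snd f p / j) * k,
        (- partial_fst g p / j) * h + partial_fst f p / j * k)"
    have "(K has_derivative ?G) (at q)"
    proof (rule has_derivative_inverse_basic[where f = F and T = V])
      show "(F has_derivative (\<lambda>x. (partial_fst f p * fst x + partial_snd f p * snd x,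
          partial_fst g p * fst x + partial_snd g p * snd x))) (at (K q))"
        unfolding F_eq p_def[symmetric]
        using holomorphic2_on_has_derivative[OF fg(1) p] holomorphic2_on_has_derivative[OF fg(2) p]
        by (intro has_derivative_Pair) (simp_all add: case_prod_beta')
      show "bounded_linear ?G"
        unfolding case_prod_beta by (intro bounded_linear_intros)
      have "(d / j * (a * x + b * y) + (- b / j) * (c * x + d * y),
          (- c / j) * (a * x + b * y) + a / j * (c * x + d * y)) = (x, y)"
        if "j = a * d - b * c" for a b c d x y
      proof -
        have "d / j * (a * x + b * y) + (- b / j) * (c * x + d * y) = (a * d - b * c) / j * x"
          "(- c / j) * (a * x + b * y) + a / j * (c * x + d * y) = (a * d - b * c) / j * y"
          by (simp_all add: diff_divide_distrib add_divide_distrib algebra_simps)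
        then show ?thesis using j by (simp flip: that)
      qed
      from this[OF j_def[unfolded jacobian2_def]]
      show "?G \<circ> (\<lambda>x. (partial_fst f p * fst x + partial_snd f p * snd x,
          partial_fst g p * fst x + partial_snd g p * snd x)) = id"
        by (auto simp: fun_eq_iff)
      show "isCont K q"
        using hom q \<open>open V\<close> by (auto simp: homeomorphism_def continuous_on_eq_continuous_at)
    qed (use hom q \<open>open V\<close> in \<open>auto simp: homeomorphism_def\<close>)
    from has_derivative_fst[OF this] has_derivative_snd[OF this]
    have "(fst \<circ> K has_derivative (\<lambda>(h, k). partial_snd g p / j * h + (- partial_snd f p / j) * k)) (at q)"
      "(snd \<circ> K has_derivative (\<lambda>(h, k). (- partial_fst g p / j) * h + partial_fst f p / j * k)) (at q)"
      by (simp_all only: o_def case_prod_beta' fst_conv snd_conv)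
    then show ?thesis by blast
  qed
  then show ?thesis by (simp add: holomorphic_map_on_def holomorphic2_on_def)
qed

section \<open>A parametrization of the symmetrized bidisc by the bidisc\<close>

text \<open>
  The parametrization is real analytic, but not holomorphic.  The second coordinate of a point
  \<open>(s, p)\<close> is kept; the first one becomes the number \<open>\<beta>\<close> with \<open>s = \<beta> + p cnj \<beta>\<close>, which exists and is
  unique for \<open>\<bar>p\<bar> < 1\<close>.
\<close>
definition sym_param :: "complex \<times> complex \<Rightarrow> complex \<times> complex"
  where "sym_param = (\<lambda>(\<beta>, z). (\<beta> + z * cnj \<beta>, z))"

text \<open>
  The inverse of \<open>sym_param\<close>, obtained by eliminating \<open>cnj \<beta>\<close> from \<open>s = \<beta> + p cnj \<beta>\<close> and its conjugate.
\<close>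
definition sym_coords :: "complex \<times> complex \<Rightarrow> complex \<times> complex"
  where "sym_coords = (\<lambda>(s, p). ((s - p * cnj s) / (1 - p * cnj p), p))"

lemma one_minus_mult_cnj_neq_0:
  assumes "norm p < 1"
  shows "1 - p * cnj p \<noteq> 0"
proof -
  have "norm (p * cnj p) < 1"
    using assms by (simp add: norm_mult abs_square_less_1 flip: power2_eq_square)
  then show ?thesis by auto
qed

text \<open>
  This equation governs both the inversion of \<open>sym_param\<close> and the inversion of its derivative, which
  is of the same shape because \<open>sym_param\<close> is real affine in \<open>\<beta>\<close>.
\<close>
lemma conj_linear_equation:
  assumes "norm z < 1"
  shows "h = (u - z * cnj u) / (1 - z * cnj z) \<longleftrightarrow> h + z * cnj h = u"
proof
  define d where "d = 1 - z * cnj z"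
  have d: "d \<noteq> 0" "cnj d = d" using one_minus_mult_cnj_neq_0[OF assms] by (auto simp: d_def)
  show "h + z * cnj h = u" if "h = (u - z * cnj u) / (1 - z * cnj z)"
  proof -
    have h: "d * h = u - z * cnj u" using that d(1) by (simp add: d_def)
    from arg_cong[OF this, of cnj] have "d * cnj h = cnj u - cnj z * u" by (simp add: d(2))
    with h have "d * (h + z * cnj h) = (u - z * cnj u) + z * (cnj u - cnj z * u)"
      by (simp only: distrib_left mult.left_commute[of d])
    also have "\<dots> = d * u" by (simp add: d_def algebra_simps)
    finally show ?thesis using d(1) by simp
  qed
  show "h = (u - z * cnj u) / (1 - z * cnj z)" if "h + z * cnj h = u"
    unfolding that[symmetric] using d(1) by (simp add: d_def eq_divide_eq algebra_simps)
qed

lemma sym_coords_sym_param: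
  "norm (snd q) < 1 \<Longrightarrow> sym_coords (sym_param q) = q"
  using conj_linear_equation[THEN iffD2, OF _ refl, of "snd q" "fst q", symmetric]
  by (simp add: sym_coords_def sym_param_def case_prod_beta prod_eq_iff)

lemma sym_param_sym_coords:
  "norm (snd q) < 1 \<Longrightarrow> sym_param (sym_coords q) = q"
  using conj_linear_equation[of "snd q" "fst (sym_coords q)" "fst q"]
  by (simp add: sym_coords_def sym_param_def case_prod_beta prod_eq_iff)

text \<open>
  If \<open>z\<close> and \<open>w\<close> are the roots of \<open>X\<^sup>2 - s X + p\<close> with \<open>s = \<beta> + p cnj \<beta>\<close>, then
  \<open>p (1 - cnj \<beta> z) = z (\<beta> - z)\<close>, so that \<open>p\<close> is \<open>- z\<close> times the Blaschke factor of \<open>\<beta>\<close> at \<open>z\<close>.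
  Both factors have modulus at least one if \<open>z\<close> lies outside the open disc, contradicting \<open>\<bar>p\<bar> < 1\<close>.
  At the pole of the Blaschke factor the identity forces \<open>z = \<beta>\<close>, impossible because \<open>\<bar>\<beta>\<bar> < 1 \<le> \<bar>z\<bar>\<close>.
\<close>
lemma root_in_unit_disc:
  fixes z w \<beta> :: complex
  assumes "norm \<beta> < 1" and "norm (z * w) < 1" and sum: "z + w = \<beta> + (z * w) * cnj \<beta>"
  shows "norm z < 1"
proof (rule ccontr)
  assume "\<not> norm z < 1"
  then have z: "norm z \<ge> 1" by simp
  define m where "m = norm (1 - cnj \<beta> * z)"
  have "(z * w) * (1 - cnj \<beta> * z) = z * (z + w) - cnj \<beta> * (z * w) * z - z * z"
    by (simp add: algebra_simps)
  also have "\<dots> = z * (\<beta> - z)"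
    unfolding sum by (simp add: algebra_simps)
  finally have eq: "(z * w) * (1 - cnj \<beta> * z) = z * (\<beta> - z)" .
  have "complex_of_real ((norm (\<beta> - z))\<^sup>2 - m\<^sup>2)
      = complex_of_real (((norm z)\<^sup>2 - 1) * (1 - (norm \<beta>)\<^sup>2))"
    unfolding m_def by (simp only: of_real_diff of_real_mult of_real_1 complex_norm_square)
      (simp add: algebra_simps)
  then have "(norm (\<beta> - z))\<^sup>2 - m\<^sup>2 = ((norm z)\<^sup>2 - 1) * (1 - (norm \<beta>)\<^sup>2)"
    by (simp only: of_real_eq_iff)
  moreover have "(norm z)\<^sup>2 \<ge> 1" "(norm \<beta>)\<^sup>2 \<le> 1"
    using z assms(1) by (simp_all add: abs_square_le_1)
  ultimately have "m\<^sup>2 \<le> (norm (\<beta> - z))\<^sup>2" by (smt (verit) mult_nonneg_nonneg)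
  then have "m \<le> norm (\<beta> - z)" by (rule power2_le_imp_le) simp
  also have "\<dots> \<le> norm z * norm (\<beta> - z)" using z by (simp add: mult_le_cancel_right1)
  also have "\<dots> = norm (z * w) * m" using arg_cong[OF eq, of norm] by (simp only: m_def norm_mult)
  finally have "m * (1 - norm (z * w)) \<le> 0" by (simp add: algebra_simps)
  moreover have "m \<ge> 0" by (simp add: m_def)
  ultimately have "m = 0" using assms(2) by (smt (verit) mult_pos_pos)
  then have "z * (\<beta> - z) = 0" using eq by (simp add: m_def)
  then show False using z assms(1) by auto
qed

lemma sym_param_in_symmetrized_bidisc:
  assumes "q \<in> unit_disc \<times> unit_disc"
  shows "sym_param q \<in> symmetrized_bidisc"
proof -
  obtain \<beta> p where q: "q = (\<beta>, p)" "norm \<beta> < 1" "norm p < 1" using assms by auto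
  define s where "s = \<beta> + p * cnj \<beta>"
  define z w where "z = (s + csqrt (s\<^sup>2 - 4 * p)) / 2" and "w = (s - csqrt (s\<^sup>2 - 4 * p)) / 2"
  have sum: "z + w = s" by (simp add: z_def w_def field_simps)
  have "z * w = (s\<^sup>2 - (csqrt (s\<^sup>2 - 4 * p))\<^sup>2) / 4"
    by (simp add: z_def w_def power2_eq_square algebra_simps)
  then have prod: "z * w = p" by simp
  have "norm z < 1" "norm w < 1"
    using root_in_unit_disc[of \<beta> z w] root_in_unit_disc[of \<beta> w z] q sum prod
    by (simp_all add: s_def mult.commute add.commute)
  then have "z \<in> unit_disc" "w \<in> unit_disc" by simp_all
  moreover have "sym_param q = (z + w, z * w)"
    unfolding sum prod by (simp add: sym_param_def q s_def)
  ultimately show ?thesis unfolding symmetrized_bidisc_def by blast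
qed

text \<open>
  For \<open>s = z + w\<close> and \<open>p = z w\<close> one has \<open>s - p cnj s = z (1 - \<bar>w\<bar>\<^sup>2) + w (1 - \<bar>z\<bar>\<^sup>2)\<close>.  With \<open>a = \<bar>z\<bar>\<close> and \<open>b = \<bar>w\<bar>\<close>
  its modulus is at most \<open>(a + b) (1 - a b)\<close>, and \<open>a + b < 1 + a b\<close> because \<open>(1 - a) (1 - b) > 0\<close>.
\<close>
lemma sym_coords_in_bidisc:
  assumes "q \<in> symmetrized_bidisc"
  shows "sym_coords q \<in> unit_disc \<times> unit_disc"
proof -
  obtain z w where q: "q = (z + w, z * w)" and zw: "norm z < 1" "norm w < 1"
    using assms by (auto simp: symmetrized_bidisc_def)
  define a b where "a = norm z" and "b = norm w"
  have ab: "0 \<le> a" "a < 1" "0 \<le> b" "b < 1" using zw by (auto simp: a_def b_def)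
  then have ab1: "a * b < 1" using mult_left_le[of b a] by linarith
  have sq: "z * cnj z = of_real (a\<^sup>2)" "w * cnj w = of_real (b\<^sup>2)"
    unfolding a_def b_def complex_norm_square by simp_all
  have "(z + w) - (z * w) * cnj (z + w) = z * (1 - w * cnj w) + w * (1 - z * cnj z)"
    by (simp add: algebra_simps)
  also have "\<dots> = z * of_real (1 - b\<^sup>2) + w * of_real (1 - a\<^sup>2)"
    unfolding sq by simp
  also have "norm \<dots> \<le> a * (1 - b\<^sup>2) + b * (1 - a\<^sup>2)"
    using ab by (intro order.trans[OF norm_triangle_ineq])
      (simp add: norm_mult a_def[symmetric] b_def[symmetric] abs_square_le_1 del: of_real_diff of_real_power)
  also have "\<dots> = (a + b) * (1 - a * b)" by (simp add: algebra_simps power2_eq_square)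
  also have "\<dots> < (1 + a * b) * (1 - a * b)"
  proof (rule mult_strict_right_mono)
    have "0 < (1 - a) * (1 - b)" using ab by simp
    then show "a + b < 1 + a * b" by (simp add: algebra_simps)
  qed (use ab1 in simp)
  also have "\<dots> = norm (1 - (z * w) * cnj (z * w))"
  proof -
    have "1 - (z * w) * cnj (z * w) = 1 - (z * cnj z) * (w * cnj w)" by simp
    also have "\<dots> = of_real ((1 + a * b) * (1 - a * b))"
      unfolding sq by (simp add: algebra_simps power2_eq_square)
    finally show ?thesis using ab ab1 by (simp only: norm_of_real) simp
  qed
  finally have "norm ((z + w) - (z * w) * cnj (z + w)) < norm (1 - (z * w) * cnj (z * w))" .
  moreover have "norm (z * w) < 1" using ab1 by (simp add: norm_mult a_def b_def)
  moreover have "norm (1 - (z * w) * cnj (z * w)) > 0"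
    using one_minus_mult_cnj_neq_0[OF \<open>norm (z * w) < 1\<close>] by simp
  ultimately show ?thesis
    unfolding q sym_coords_def by (simp only: case_prod_conv mem_Times_iff fst_conv snd_conv
      mem_ball_0 norm_divide divide_less_eq_1_pos simp_thms)
qed

lemma homeomorphism_sym_param:
  "homeomorphism (unit_disc \<times> unit_disc) symmetrized_bidisc sym_param sym_coords"
proof (rule homeomorphismI)
  have "norm (snd q) < 1" if "q \<in> symmetrized_bidisc" for q
    using sym_coords_in_bidisc[OF that] by (simp add: sym_coords_def case_prod_beta)
  note p = this
  show "continuous_on (unit_disc \<times> unit_disc) sym_param"
    unfolding sym_param_def case_prod_beta by (intro continuous_intros)
  show "continuous_on symmetrized_bidisc sym_coords"
    unfolding sym_coords_def case_prod_beta
    by (intro continuous_intros) (use p one_minus_mult_cnj_neq_0 in blast)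
  show "sym_param (sym_coords q) = q" if "q \<in> symmetrized_bidisc" for q
    using p[OF that] by (rule sym_param_sym_coords)
  show "sym_coords (sym_param q) = q" if "q \<in> unit_disc \<times> unit_disc" for q
    using that by (intro sym_coords_sym_param) auto
  show "sym_param ` (unit_disc \<times> unit_disc) \<subseteq> symmetrized_bidisc"
    using sym_param_in_symmetrized_bidisc by blast
  show "sym_coords ` symmetrized_bidisc \<subseteq> unit_disc \<times> unit_disc"
    using sym_coords_in_bidisc by blast
qed

text \<open>
  An injective continuous image of an open subset of \<open>\<real>\<^sup>4\<close> is open (invariance of domain).
\<close>
lemma open_symmetrized_bidisc: "open symmetrized_bidisc"
proof -
  have "inj_on sym_param (unit_disc \<times> unit_disc)"
    by (rule inj_on_inverseI[of _ sym_coords]) (auto simp: sym_coords_sym_param)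
  then have "open (sym_param ` (unit_disc \<times> unit_disc))"
    using homeomorphism_sym_param
    by (intro invariance_of_domain) (auto simp: homeomorphism_def open_Times)
  then show ?thesis using homeomorphism_sym_param by (simp add: homeomorphism_def)
qed

lemma has_derivative_sym_param:
  "(sym_param has_derivative (\<lambda>(h, k). (h + z * cnj h + cnj \<beta> * k, k))) (at (\<beta>, z))"
  unfolding sym_param_def case_prod_beta
  by (rule has_derivative_eq_rhs, (rule derivative_intros bounded_linear.has_derivative[OF bounded_linear_cnj])+)
    (simp add: fun_eq_iff algebra_simps)

lemma has_derivative_sym_coords:
  assumes "(\<beta>, z) \<in> unit_disc \<times> unit_disc"
  shows "(sym_coords has_derivative (\<lambda>(x, y).
    ((x - cnj \<beta> * y - z * cnj (x - cnj \<beta> * y)) / (1 - z * cnj z), y))) (at (sym_param (\<beta>, z)))"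
    (is "(_ has_derivative ?M) _")
proof (rule has_derivative_inverse_basic[where f = sym_param and T = symmetrized_bidisc])
  have z: "norm z < 1" using assms by simp
  note d = one_minus_mult_cnj_neq_0[OF z]
  show "(sym_param has_derivative (\<lambda>(h, k). (h + z * cnj h + cnj \<beta> * k, k)))
      (at (sym_coords (sym_param (\<beta>, z))))"
    using z by (simp add: sym_coords_sym_param has_derivative_sym_param)
  show "bounded_linear ?M"
    unfolding case_prod_beta divide_inverse
    by (intro bounded_linear_intros bounded_linear_compose[OF bounded_linear_cnj])
  have "(u - z * cnj u) / (1 - z * cnj z) = h" if "u = h + z * cnj h" for u h
    using conj_linear_equation[OF z, of h u] that by simp
  then show "?M \<circ> (\<lambda>(h, k). (h + z * cnj h + cnj \<beta> * k, k)) = id"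
    by (auto simp: fun_eq_iff)
  show "sym_param (\<beta>, z) \<in> symmetrized_bidisc" using assms by (rule sym_param_in_symmetrized_bidisc)
  then show "isCont sym_coords (sym_param (\<beta>, z))"
    using homeomorphism_sym_param open_symmetrized_bidisc
    by (auto simp: homeomorphism_def continuous_on_eq_continuous_at)
qed (use homeomorphism_sym_param open_symmetrized_bidisc in \<open>auto simp: homeomorphism_def\<close>)

section \<open>The differential equations express holomorphy on the symmetrized bidisc\<close>

lemma wirtinger_eqI:
  assumes "(f has_derivative (\<lambda>h. A * h + B * cnj h)) (at z)"
  shows "wirtinger f z = A" and "wirtinger_bar f z = B"
  using frechet_derivative_at[OF assms, symmetric]
  by (simp_all add: wirtinger_def wirtinger_bar_def algebra_simps)

lemma has_derivative_wirtinger: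
  assumes "f differentiable at z"
  shows "(f has_derivative (\<lambda>h. wirtinger f z * h + wirtinger_bar f z * cnj h)) (at z)"
proof -
  let ?L = "frechet_derivative f (at z)"
  have L: "(f has_derivative ?L) (at z)" using assms by (simp add: frechet_derivative_works)
  interpret L: linear ?L using L by (rule has_derivative_linear)
  have "?L h = wirtinger f z * h + wirtinger_bar f z * cnj h" for h
  proof -
    have "?L h = ?L (Re h *\<^sub>R 1 + Im h *\<^sub>R \<i>)"
      by (rule arg_cong[of _ _ ?L]) (simp add: complex_eq_iff)
    also have "\<dots> = of_real (Re h) * ?L 1 + of_real (Im h) * ?L \<i>"
      by (simp only: L.add L.scale) (simp only: scaleR_conv_of_real)
    also have "\<dots> = (h + cnj h) / 2 * ?L 1 + (- \<i> * (h - cnj h) / 2) * ?L \<i>"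
      by (intro arg_cong2[of _ _ _ _ "(+)"] arg_cong2[of _ _ _ _ "(*)"] refl) (simp_all add: complex_eq_iff)
    also have "\<dots> = wirtinger f z * h + wirtinger_bar f z * cnj h"
      by (simp add: wirtinger_def wirtinger_bar_def field_simps)
    finally show ?thesis .
  qed
  then have "?L = (\<lambda>h. wirtinger f z * h + wirtinger_bar f z * cnj h)" by blast
  with L show ?thesis by simp
qed

text \<open>
  By the chain rule the differential of \<open>f \<circ> sym_param\<close> is \<open>a (d\<beta> + z d(cnj \<beta>) + cnj \<beta> dz) + b dz\<close>.
  The coefficient of \<open>d(cnj \<beta>)\<close> is \<open>z\<close> times that of \<open>d\<beta>\<close>, and \<open>d(cnj z)\<close> does not occur.
\<close>
lemma wirtinger_slices_sym_param:
  assumes "(f has_derivative (\<lambda>(h, k). a * h + b * k)) (at (sym_param (\<beta>, z)))"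
  shows "wirtinger_bar (\<lambda>x. (f \<circ> sym_param) (x, z)) \<beta> = z * wirtinger (\<lambda>x. (f \<circ> sym_param) (x, z)) \<beta>"
    and "wirtinger_bar (\<lambda>y. (f \<circ> sym_param) (\<beta>, y)) z = 0"
proof -
  note slices = slices_has_derivative[OF diff_chain_at[OF has_derivative_sym_param assms]]
  have "((\<lambda>x. (f \<circ> sym_param) (x, z)) has_derivative (\<lambda>h. a * h + (a * z) * cnj h)) (at \<beta>)"
    by (rule has_derivative_eq_rhs[OF slices(1)]) (simp add: fun_eq_iff algebra_simps)
  from wirtinger_eqI[OF this]
  show "wirtinger_bar (\<lambda>x. (f \<circ> sym_param) (x, z)) \<beta> = z * wirtinger (\<lambda>x. (f \<circ> sym_param) (x, z)) \<beta>"
    by simp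
  have "((\<lambda>y. (f \<circ> sym_param) (\<beta>, y)) has_derivative (\<lambda>k. (a * cnj \<beta> + b) * k + 0 * cnj k)) (at z)"
    by (rule has_derivative_eq_rhs[OF slices(2)]) (simp add: fun_eq_iff algebra_simps)
  from wirtinger_eqI(2)[OF this]
  show "wirtinger_bar (\<lambda>y. (f \<circ> sym_param) (\<beta>, y)) z = 0" .
qed

text \<open>
  Conversely, the equations turn the differential of \<open>\<xi>\<close> into \<open>A (d\<beta> + z d(cnj \<beta>)) + C dz\<close>.  As
  \<open>s = \<beta> + z cnj \<beta>\<close> gives \<open>d\<beta> + z d(cnj \<beta>) = ds - cnj \<beta> dz\<close>, this is \<open>A ds + (C - A cnj \<beta>) dp\<close> in the
  coordinates \<open>s\<close> and \<open>p = z\<close>.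
\<close>
lemma holomorphic_in_symmetric_coordinates:
  assumes q: "(\<beta>, z) \<in> unit_disc \<times> unit_disc" and diff: "\<xi> differentiable at (\<beta>, z)"
    and pde_\<beta>: "wirtinger_bar (\<lambda>x. \<xi> (x, z)) \<beta> = z * wirtinger (\<lambda>x. \<xi> (x, z)) \<beta>"
    and pde_z: "wirtinger_bar (\<lambda>y. \<xi> (\<beta>, y)) z = 0"
  shows "\<exists>a b. (\<xi> \<circ> sym_coords has_derivative (\<lambda>(h, k). a * h + b * k)) (at (sym_param (\<beta>, z)))"
proof -
  obtain L where L: "(\<xi> has_derivative L) (at (\<beta>, z))" using diff by (auto simp: differentiable_def)
  interpret L: linear L using L by (rule has_derivative_linear)
  define A C where "A = wirtinger (\<lambda>x. \<xi> (x, z)) \<beta>" and "C = wirtinger (\<lambda>y. \<xi> (\<beta>, y)) z"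
  note slices = slices_has_derivative[OF L]
  have "(\<lambda>h. L (h, 0)) = (\<lambda>h. A * h + (z * A) * cnj h)"
    using has_derivative_unique[OF slices(1) has_derivative_wirtinger[OF differentiableI[OF slices(1)]]]
    by (simp only: pde_\<beta> A_def)
  moreover have "(\<lambda>k. L (0, k)) = (\<lambda>k. C * k)"
    using has_derivative_unique[OF slices(2) has_derivative_wirtinger[OF differentiableI[OF slices(2)]]]
    by (simp add: pde_z C_def)
  ultimately have L_eq: "L (h, k) = A * (h + z * cnj h) + C * k" for h k
    using L.add[of "(h, 0)" "(0, k)"] by (simp add: fun_eq_iff algebra_simps)
  have "norm z < 1" using q by simp
  note inv = conj_linear_equation[OF this, THEN iffD1, OF refl]
  have z: "sym_coords (sym_param (\<beta>, z)) = (\<beta>, z)" using q by (simp add: sym_coords_sym_param)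
  have "(\<xi> \<circ> sym_coords has_derivative (\<lambda>(x, y). A * x + (C - A * cnj \<beta>) * y)) (at (sym_param (\<beta>, z)))"
    by (rule has_derivative_eq_rhs[OF diff_chain_at[OF has_derivative_sym_coords[OF q]]], unfold z, rule L)
      (simp add: fun_eq_iff L_eq inv del: complex_cnj_divide complex_cnj_diff, simp add: algebra_simps)
  then show ?thesis by blast
qed

section \<open>The characterization\<close>

lemma holomorphic_map_on_imp_continuous_on:
  assumes "holomorphic_map_on F U"
  shows "continuous_on U F"
proof -
  have "continuous_on U (\<lambda>p. ((fst \<circ> F) p, (snd \<circ> F) p))"
    using assms unfolding holomorphic_map_on_def
    by (blast intro: continuous_on_Pair holomorphic2_on_imp_continuous_on)
  then show ?thesis by simp
qed

theorem theorem3p2: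
  fixes \<Omega> :: "(complex \<times> complex) set"
  assumes "open \<Omega>" and "connected \<Omega>"
  shows "biholomorphic \<Omega> symmetrized_bidisc \<longleftrightarrow>
    (\<exists>\<Xi> \<Psi>. homeomorphism (unit_disc \<times> unit_disc) \<Omega> \<Xi> \<Psi> \<and>
      \<Xi> differentiable_on (unit_disc \<times> unit_disc) \<and>
      (\<forall>\<xi>\<in>{fst \<circ> \<Xi>, snd \<circ> \<Xi>}. \<forall>\<beta>\<in>unit_disc. \<forall>z\<in>unit_disc.
        wirtinger_bar (\<lambda>b. \<xi> (b, z)) \<beta> = z * wirtinger (\<lambda>b. \<xi> (b, z)) \<beta> \<and>
        wirtinger_bar (\<lambda>w. \<xi> (\<beta>, w)) z = 0))"
    (is "?lhs \<longleftrightarrow> ?rhs")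
proof
  assume ?lhs
  then obtain F H where F: "holomorphic_map_on F \<Omega>" and H: "holomorphic_map_on H symmetrized_bidisc"
    and FH: "F ` \<Omega> = symmetrized_bidisc" "H ` symmetrized_bidisc = \<Omega>"
      "\<forall>p\<in>\<Omega>. H (F p) = p" "\<forall>q\<in>symmetrized_bidisc. F (H q) = q"
    unfolding biholomorphic_def by blast
  have "homeomorphism symmetrized_bidisc \<Omega> H F"
    using FH F H by (auto simp: homeomorphism_def holomorphic_map_on_imp_continuous_on)
  then have hom: "homeomorphism (unit_disc \<times> unit_disc) \<Omega> (H \<circ> sym_param) (sym_coords \<circ> F)"
    by (rule homeomorphism_compose[OF homeomorphism_sym_param])
  have comp: "\<exists>a b. (h has_derivative (\<lambda>(h, k). a * h + b * k)) (at (sym_param q))"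
    if "h \<in> {fst \<circ> H, snd \<circ> H}" "q \<in> unit_disc \<times> unit_disc" for h q
    using H that sym_param_in_symmetrized_bidisc[OF that(2)]
    by (auto simp: holomorphic_map_on_def holomorphic2_on_def)
  have "(H \<circ> sym_param) differentiable (at q)" if q: "q \<in> unit_disc \<times> unit_disc" for q
  proof -
    obtain \<beta> z where "q = (\<beta>, z)" by force
    obtain L1 L2 where "(fst \<circ> H has_derivative L1) (at (sym_param q))"
      "(snd \<circ> H has_derivative L2) (at (sym_param q))"
      using comp[OF _ q] by blast
    then have "(H has_derivative (\<lambda>x. (L1 x, L2 x))) (at (sym_param q))"
      using has_derivative_Pair by fastforce
    with has_derivative_sym_param[of z \<beta>] show ?thesis
      unfolding \<open>q = (\<beta>, z)\<close> by (blast intro: differentiableI diff_chain_at)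
  qed
  then have "(H \<circ> sym_param) differentiable_on (unit_disc \<times> unit_disc)"
    by (simp add: differentiable_at_imp_differentiable_on)
  moreover have "wirtinger_bar (\<lambda>b. \<xi> (b, z)) \<beta> = z * wirtinger (\<lambda>b. \<xi> (b, z)) \<beta> \<and>
      wirtinger_bar (\<lambda>w. \<xi> (\<beta>, w)) z = 0"
    if \<xi>: "\<xi> \<in> {fst \<circ> (H \<circ> sym_param), snd \<circ> (H \<circ> sym_param)}"
      and q: "\<beta> \<in> unit_disc" "z \<in> unit_disc" for \<xi> \<beta> z
  proof -
    have "\<xi> = (fst \<circ> H) \<circ> sym_param \<or> \<xi> = (snd \<circ> H) \<circ> sym_param"
      using \<xi> by (simp only: comp_assoc insert_iff empty_iff simp_thms)
    then obtain h where h: "h \<in> {fst \<circ> H, snd \<circ> H}" and \<xi>_eq: "\<xi> = h \<circ> sym_param"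
      by blast
    obtain a b where "(h has_derivative (\<lambda>(h, k). a * h + b * k)) (at (sym_param (\<beta>, z)))"
      using comp[OF h, of "(\<beta>, z)"] q by blast
    from wirtinger_slices_sym_param[OF this] show ?thesis unfolding \<xi>_eq by blast
  qed
  ultimately show ?rhs using hom by blast
next
  assume ?rhs
  then obtain \<Xi> \<Psi> where hom: "homeomorphism (unit_disc \<times> unit_disc) \<Omega> \<Xi> \<Psi>"
    and diff: "\<Xi> differentiable_on (unit_disc \<times> unit_disc)"
    and pde: "\<forall>\<xi>\<in>{fst \<circ> \<Xi>, snd \<circ> \<Xi>}. \<forall>\<beta>\<in>unit_disc. \<forall>z\<in>unit_disc.
        wirtinger_bar (\<lambda>b. \<xi> (b, z)) \<beta> = z * wirtinger (\<lambda>b. \<xi> (b, z)) \<beta> \<and>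
        wirtinger_bar (\<lambda>w. \<xi> (\<beta>, w)) z = 0"
    by blast
  define H K where "H = \<Xi> \<circ> sym_coords" and "K = sym_param \<circ> \<Psi>"
  have hom': "homeomorphism symmetrized_bidisc \<Omega> H K"
    unfolding H_def K_def
    by (rule homeomorphism_compose[OF homeomorphism_symD[OF homeomorphism_sym_param] hom])
  have "holomorphic2_on (\<xi> \<circ> sym_coords) symmetrized_bidisc" if \<xi>: "\<xi> \<in> {fst \<circ> \<Xi>, snd \<circ> \<Xi>}" for \<xi>
    unfolding holomorphic2_on_def
  proof
    fix x assume x: "x \<in> symmetrized_bidisc"
    obtain \<beta> z where q: "sym_coords x = (\<beta>, z)" by force
    have mem: "(\<beta>, z) \<in> unit_disc \<times> unit_disc" using sym_coords_in_bidisc[OF x] by (simp only: q)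
    have x_eq: "x = sym_param (\<beta>, z)"
      using homeomorphism_apply2[OF homeomorphism_sym_param x] by (simp only: q)
    have "\<Xi> differentiable (at (\<beta>, z))"
      using diff mem by (simp add: differentiable_on_eq_differentiable_at open_Times)
    then have "\<xi> differentiable (at (\<beta>, z))"
      using \<xi> unfolding differentiable_def o_def
      by (blast intro: has_derivative_fst has_derivative_snd)
    then show "\<exists>a b. (\<xi> \<circ> sym_coords has_derivative (\<lambda>(h, k). a * h + b * k)) (at x)"
      unfolding x_eq using pde \<xi> mem by (intro holomorphic_in_symmetric_coordinates) auto
  qed
  then have H: "holomorphic_map_on H symmetrized_bidisc"
    unfolding holomorphic_map_on_def H_def comp_assoc[symmetric] by blast
  have "holomorphic_map_on K \<Omega>"
    by (rule inverse_of_injective_holomorphic_map[OF open_symmetrized_bidisc \<open>open \<Omega>\<close> H hom'])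
  with H hom' show ?lhs
    unfolding biholomorphic_def homeomorphism_def by blast
qed

end
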